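(* A triangle-free graph $G$ on $n \geq 5$ vertices is strongly $T_3$-reconstructible if and only if $N(v_1) \neq N(v_2)$ for any two distinct non-adjacent vertices $v_1, v_2 \in V(G)$.
   Context: Graphs are finite, simple, connected and labeled; two labeled graphs are identical iff they have the same vertex set and edge set. $N(v)$ is the set of neighbors of $v$. $T_3(G)$ is the set of 3-element subsets of $V(G)$ inducing a connected subgraph of $G$. $G$ is strongly $T_3$-reconstructible if every finite, simple, connected labeled graph $H$ with $T_3(H) = T_3(G)$ is identical to $G$. *)

theory Defs
  imports "Graph_Theory.Graph_Theory"
begin

(* A finite simple graph is a pair_graph: every undirected edge uv is represented by the
   two arcs (u,v) and (v,u) of the symmetric, irreflexive relation parcs G. *)

definition conn_simple_graph :: "'a pair_pre_digraph \<Rightarrow> bool" where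
  "conn_simple_graph G \<longleftrightarrow> pair_graph G \<and> Digraph_Component.connected (with_proj G)"

definition nbrs :: "'a pair_pre_digraph \<Rightarrow> 'a \<Rightarrow> 'a set" where
  "nbrs G v = {w. (v, w) \<in> parcs G}"

definition triangle_free :: "'a pair_pre_digraph \<Rightarrow> bool" where
  "triangle_free G \<longleftrightarrow>
     \<not> (\<exists>u v w. (u, v) \<in> parcs G \<and> (v, w) \<in> parcs G \<and> (w, u) \<in> parcs G)"

definition T3 :: "'a pair_pre_digraph \<Rightarrow> 'a set set" where
  "T3 G = {S. S \<subseteq> pverts G \<and> card S = 3 \<and>
              Digraph_Component.connected (with_proj G \<restriction> S)}"

(* H may be taken over the same type 'a: a connected graph with nonempty T3 is covered by the
   triples in its T3, so T3 H = T3 G already forces the vertices of H to be those of G whenever G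
   has at least three vertices. No equality of vertex sets is assumed. *)

definition strongly_T3_reconstructible :: "'a pair_pre_digraph \<Rightarrow> bool" where
  "strongly_T3_reconstructible G \<longleftrightarrow>
     (\<forall>H :: 'a pair_pre_digraph. conn_simple_graph H \<and> T3 H = T3 G \<longrightarrow>
        pverts H = pverts G \<and> parcs H = parcs G)"

end

(* A triple is in T3 iff it spans at least two edges, so joining two non-adjacent twins by an edge
   does not change T3.

   Conversely let T3 H = T3 G. If xy is an edge of H only, every further H-neighbour of x or y is
   a G-neighbour of both; if xy is an edge of G only, every further G-neighbour of x or y is an
   H-neighbour of both. Suppose xy is an edge of H only. As x and y are not twins in G, some z is
   adjacent to x but not to y, and the rules produce a vertex w such that y-w-x-z is an induced
   path in G and y-x-w-z is one in H. A fifth vertex attached to {x, y, z, w} would then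
   close a triangle of G. So H is a subgraph of G, and an edge of G missing from H would
   again close a triangle of G. *)

theory Submission
  imports Defs
begin

text \<open>A walk from inside \<open>A\<close> to a vertex outside must leave \<open>A\<close>
  along some arc; conversely, no arc leaves the set of vertices reachable from \<open>u\<close>, so
  that set is everything. In this form, connectivity of a triple is a check on its subsets, and
  connectivity of a graph yields an edge leaving any small vertex set.\<close>

lemma connected_iff_cut:
  "Digraph_Component.connected G \<longleftrightarrow> verts G \<noteq> {} \<and>
     (\<forall>A \<subseteq> verts G. A \<noteq> {} \<and> A \<noteq> verts G \<longrightarrow>
        (\<exists>x\<in>A. \<exists>y\<in>verts G - A. (x, y) \<in> (arcs_ends G)\<^sup>s))"
    (is "_ \<longleftrightarrow> _ \<and> ?cut")
proof -
  have "(\<forall>u\<in>verts G. \<forall>v\<in>verts G. (u, v) \<in> rtrancl_on (verts G) ((arcs_ends G)\<^sup>s)) \<longleftrightarrow> ?cut"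
  proof (intro iffI allI impI ballI)
    fix A assume reach: "\<forall>u\<in>verts G. \<forall>v\<in>verts G. (u, v) \<in> rtrancl_on (verts G) ((arcs_ends G)\<^sup>s)"
      and A: "A \<subseteq> verts G" "A \<noteq> {} \<and> A \<noteq> verts G"
    then obtain u v where uv: "u \<in> A" "v \<in> verts G" "v \<notin> A" by blast
    with reach A have "(u, v) \<in> rtrancl_on (verts G) ((arcs_ends G)\<^sup>s)" by blast
    from this uv show "\<exists>x\<in>A. \<exists>y\<in>verts G - A. (x, y) \<in> (arcs_ends G)\<^sup>s"
      by (induction rule: rtrancl_on_induct) blast+
  next
    fix u v assume cut: ?cut and uv: "u \<in> verts G" "v \<in> verts G"
    define A where "A = {w \<in> verts G. (u, w) \<in> rtrancl_on (verts G) ((arcs_ends G)\<^sup>s)}"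
    have "u \<in> A" using uv by (simp add: A_def)
    moreover have "\<not> (\<exists>x\<in>A. \<exists>y\<in>verts G - A. (x, y) \<in> (arcs_ends G)\<^sup>s)"
      by (auto simp: A_def intro: rtrancl_on_into_rtrancl_on)
    moreover have "A \<subseteq> verts G" by (auto simp: A_def)
    ultimately have "A = verts G" using cut by blast
    with uv show "(u, v) \<in> rtrancl_on (verts G) ((arcs_ends G)\<^sup>s)" by (auto simp: A_def)
  qed
  then show ?thesis by (simp add: connected_conv)
qed

lemma conn_simple_graphD:
  assumes "conn_simple_graph G"
  shows "finite (pverts G)"
    and "(u, v) \<in> parcs G \<Longrightarrow> u \<in> pverts G"
    and "(u, v) \<in> parcs G \<Longrightarrow> v \<in> pverts G"
    and "(u, v) \<in> parcs G \<Longrightarrow> (v, u) \<in> parcs G"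
    and "(u, u) \<notin> parcs G"
    and "\<lbrakk>A \<subseteq> pverts G; A \<noteq> {}; A \<noteq> pverts G\<rbrakk> \<Longrightarrow> \<exists>x\<in>A. \<exists>y\<in>pverts G - A. (x, y) \<in> parcs G"
proof -
  interpret pair_graph G using assms by (simp add: conn_simple_graph_def)
  show "finite (pverts G)" by (rule pair_finite_verts)
  show "(u, v) \<in> parcs G \<Longrightarrow> u \<in> pverts G" "(u, v) \<in> parcs G \<Longrightarrow> v \<in> pverts G"
    by (rule in_arcsD1 in_arcsD2, assumption)+
  show sym: "\<And>u v. (u, v) \<in> parcs G \<Longrightarrow> (v, u) \<in> parcs G"
    using pair_sym_arcs by (auto simp: symmetric_def dest: symD)
  show "(u, u) \<notin> parcs G" using pair_no_loops by force
  assume "A \<subseteq> pverts G" "A \<noteq> {}" "A \<noteq> pverts G"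
  moreover have "(parcs G)\<^sup>s = parcs G" using sym by (auto simp: symcl_def)
  ultimately show "\<exists>x\<in>A. \<exists>y\<in>pverts G - A. (x, y) \<in> parcs G"
    using assms by (simp add: conn_simple_graph_def connected_iff_cut)
qed

text \<open>That the triple lies in \<open>pverts G\<close> is implicit on the right: two edges
  cover all three vertices.\<close>

lemma triple_in_T3_iff:
  assumes G: "conn_simple_graph G" and "a \<noteq> b" "a \<noteq> c" "b \<noteq> c"
  shows "{a, b, c} \<in> T3 G \<longleftrightarrow>
    (a, b) \<in> parcs G \<and> (b, c) \<in> parcs G \<or>
    (a, b) \<in> parcs G \<and> (a, c) \<in> parcs G \<or>
    (a, c) \<in> parcs G \<and> (b, c) \<in> parcs G" (is "_ \<longleftrightarrow> ?two")
proof -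
  note [dest] = conn_simple_graphD(2,3)[OF G]
  note sym = conn_simple_graphD(4)[OF G]
  interpret pair_graph G using G by (simp add: conn_simple_graph_def)
  let ?S = "{a, b, c}"
  have ends: "(x, y) \<in> (arcs_ends (with_proj G \<restriction> ?S))\<^sup>s \<longleftrightarrow> (x, y) \<in> parcs G \<and> x \<in> ?S \<and> y \<in> ?S"
    for x y
    using sym by (auto simp: arcs_ends_conv symcl_def)
  have conn: "Digraph_Component.connected (with_proj G \<restriction> ?S) \<longleftrightarrow> ?two" if sub: "?S \<subseteq> pverts G"
  proof -
    have "Digraph_Component.connected (with_proj G \<restriction> ?S) \<longleftrightarrow>
      (\<forall>A \<subseteq> ?S. A \<noteq> {} \<and> A \<noteq> ?S \<longrightarrow> (\<exists>x\<in>A. \<exists>y\<in>?S - A. (x, y) \<in> parcs G))" (is "_ \<longleftrightarrow> ?cut")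
      unfolding connected_iff_cut ends by auto
    also have "\<dots> \<longleftrightarrow> ?two"
    proof
      assume cut: ?cut
      \<comment> \<open>The singleton cuts suffice: no vertex of the triple may be isolated, and a
        single edge would leave one out.\<close>
      have "\<exists>x\<in>{v}. \<exists>y\<in>?S - {v}. (x, y) \<in> parcs G" if "v \<in> ?S" for v
        by (rule cut[rule_format]) (use that assms in auto)
      from this[of a] this[of b] this[of c] show ?two using sym assms by auto
    next
      assume two: ?two
      show ?cut
      proof (intro allI impI)
        fix A assume "A \<subseteq> ?S" "A \<noteq> {} \<and> A \<noteq> ?S"
        then show "\<exists>x\<in>A. \<exists>y\<in>?S - A. (x, y) \<in> parcs G"
          using two sym[of a b] sym[of a c] sym[of b c]
          by (cases "a \<in> A"; cases "b \<in> A"; cases "c \<in> A") auto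
      qed
    qed
    finally show ?thesis .
  qed
  have "card ?S = 3" using assms by simp
  then show ?thesis unfolding T3_def using conn by blast
qed

text \<open>At most two vertices cannot exhaust \<open>pverts G\<close>, so connectivity gives an
  edge leaving them. The case \<open>u = v\<close> is intended too: it yields a neighbour of a
  single vertex.\<close>

lemma ex_adjacent_outside_pair:
  assumes G: "conn_simple_graph G" and card: "card (pverts G) \<ge> 3"
    and "u \<in> pverts G" "v \<in> pverts G"
  obtains w where "w \<noteq> u" "w \<noteq> v" "(u, w) \<in> parcs G \<or> (v, w) \<in> parcs G"
proof -
  have "card {u, v} \<le> 2" by (simp add: card_insert_if)
  then have "{u, v} \<noteq> pverts G" using card by auto
  from conn_simple_graphD(6)[OF G _ _ this] assms that show thesis by auto
qed

text \<open>A vertex \<open>v\<close>, a neighbour \<open>u\<close> and a third vertex attached to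
  either of them span two edges. This is how \<open>T3\<close> determines the vertex set.\<close>

lemma Union_T3:
  assumes G: "conn_simple_graph G" and card: "card (pverts G) \<ge> 3"
  shows "\<Union>(T3 G) = pverts G"
proof
  show "\<Union>(T3 G) \<subseteq> pverts G" by (auto simp: T3_def)
  show "pverts G \<subseteq> \<Union>(T3 G)"
  proof
    fix v assume v: "v \<in> pverts G"
    obtain u where u: "u \<noteq> v" "(v, u) \<in> parcs G"
      using ex_adjacent_outside_pair[OF G card v v] by blast
    obtain w where w: "w \<noteq> v" "w \<noteq> u" "(v, w) \<in> parcs G \<or> (u, w) \<in> parcs G"
      using ex_adjacent_outside_pair[OF G card v conn_simple_graphD(3)[OF G u(2)]] by blast
    then have "{v, u, w} \<in> T3 G"
      using triple_in_T3_iff[OF G, of v u w] u by blast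
    then show "v \<in> \<Union>(T3 G)" by blast
  qed
qed

lemma T3_eq_imp_eq:
  assumes G: "conn_simple_graph G" and tf: "triangle_free G" and card: "card (pverts G) \<ge> 5"
    and twin_free: "\<And>v w. \<lbrakk>v \<in> pverts G; w \<in> pverts G; v \<noteq> w; (v, w) \<notin> parcs G\<rbrakk>
      \<Longrightarrow> nbrs G v \<noteq> nbrs G w"
    and H: "conn_simple_graph H" and T3: "T3 H = T3 G"
  shows "pverts H = pverts G \<and> parcs H = parcs G"
proof -
  let ?G = "parcs G" and ?H = "parcs H"
  note symG = conn_simple_graphD(4)[OF G] and symH = conn_simple_graphD(4)[OF H]
  note irrG = conn_simple_graphD(5)[OF G] and irrH = conn_simple_graphD(5)[OF H]
  have tri: False if "(a, b) \<in> ?G" "(b, c) \<in> ?G" "(c, a) \<in> ?G" for a b c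
    using tf that unfolding triangle_free_def by blast
  have card3: "card (pverts G) \<ge> 3" using card by simp
  \<comment> \<open>\<open>Union_T3\<close> can be applied to \<open>H\<close> once \<open>H\<close>
    has three vertices; any element of the nonempty \<open>T3 G = T3 H\<close> supplies
    them.\<close>
  have cardH: "card (pverts H) \<ge> 3"
  proof -
    have "\<Union>(T3 G) \<noteq> {}" using Union_T3[OF G] card by auto
    then obtain S where "S \<in> T3 H" using T3 by auto
    then show ?thesis
      using conn_simple_graphD(1)[OF H] card_mono[of "pverts H" S] by (auto simp: T3_def)
  qed
  have V: "pverts H = pverts G"
    using Union_T3[OF G] Union_T3[OF H cardH] T3 card by auto

  \<comment> \<open>In \<open>H\<close> the triple \<open>{w, x, y}\<close> spans two edges, hence
    also in \<open>G\<close>; since \<open>xy\<close> is missing there, the other two pairs are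
    edges. \<open>loss\<close> is the same with the graphs exchanged.\<close>
  have gain: "(w, x) \<in> ?G" "(w, y) \<in> ?G"
    if "(x, y) \<in> ?H" "(x, y) \<notin> ?G" "(w, x) \<in> ?H \<or> (w, y) \<in> ?H" "w \<noteq> x" "w \<noteq> y" for x y w
  proof -
    have "x \<noteq> y" using that irrH by auto
    with that triple_in_T3_iff[OF H, of w x y] triple_in_T3_iff[OF G, of w x y] T3
    show "(w, x) \<in> ?G" "(w, y) \<in> ?G" by auto
  qed
  have loss: "(w, x) \<in> ?H" "(w, y) \<in> ?H"
    if "(x, y) \<in> ?G" "(x, y) \<notin> ?H" "(w, x) \<in> ?G \<or> (w, y) \<in> ?G" "w \<noteq> x" "w \<noteq> y" for x y w
  proof -
    have "x \<noteq> y" using that irrG by auto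
    with that triple_in_T3_iff[OF H, of w x y] triple_in_T3_iff[OF G, of w x y] T3
    show "(w, x) \<in> ?H" "(w, y) \<in> ?H" by auto
  qed

  \<comment> \<open>Used for both \<open>(x, y)\<close> and \<open>(y, x)\<close>, this makes
    \<open>x\<close> and \<open>y\<close> twins in \<open>G\<close>.\<close>
  have no_private: "(y, z) \<in> ?G" if xy: "(x, y) \<in> ?H" "(x, y) \<notin> ?G" and xz: "(x, z) \<in> ?G" for x y z
  proof (rule ccontr)
    assume yz: "(y, z) \<notin> ?G"
    have ne: "x \<noteq> y" "x \<noteq> z" "y \<noteq> z" using xy xz irrG irrH by auto
    \<comment> \<open>Were \<open>z\<close> joined in \<open>H\<close> to \<open>x\<close> or to
      \<open>y\<close>, \<open>gain\<close> would put \<open>yz\<close> into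
      \<open>G\<close>.\<close>
    have xzH: "(x, z) \<notin> ?H" using gain[of x y z] xy yz symG symH ne by blast
    have yzH: "(y, z) \<notin> ?H" using gain[of x y z] xy yz symG symH ne by blast
    obtain w where w: "w \<noteq> x" "w \<noteq> y" "(x, w) \<in> ?H \<or> (y, w) \<in> ?H"
      using ex_adjacent_outside_pair[OF H cardH] conn_simple_graphD(2,3)[OF H xy(1)] by blast
    have wG: "(w, x) \<in> ?G" "(w, y) \<in> ?G" using gain[OF xy, of w] w symH by blast+
    have "w \<noteq> z" using wG yz symG by blast
    \<comment> \<open>Now \<open>xz\<close> is an edge of \<open>G\<close> only and \<open>w\<close>
      a \<open>G\<close>-neighbour of \<open>x\<close>, so \<open>loss\<close> applies. Then
      \<open>wz\<close> turns out to be an edge of \<open>H\<close> only, and an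
      \<open>H\<close>-edge \<open>wy\<close> would put \<open>yz\<close> into
      \<open>G\<close>.\<close>
    have wH: "(w, x) \<in> ?H" "(w, z) \<in> ?H"
      using loss[OF xz xzH, of w] wG \<open>w \<noteq> z\<close> w by blast+
    have wz: "(w, z) \<notin> ?G" using tri[of w z x] wG xz symG by blast
    have wyH: "(w, y) \<notin> ?H"
      using gain[OF wH(2) wz, of y] symH yz ne w by blast
    \<comment> \<open>Both \<open>xy\<close> and \<open>wz\<close> are edges of \<open>H\<close>
      only. Either alternative joins \<open>a\<close> in \<open>H\<close> to an end of each, so
      \<open>gain\<close> makes \<open>a\<close> a common \<open>G\<close>-neighbour of the adjacent
      vertices \<open>x\<close> and \<open>w\<close>. The alternatives are what \<open>loss\<close>
      yields for \<open>xz\<close> and \<open>wy\<close>, which are edges of \<open>G\<close>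
      only.\<close>
    have *: False if "a \<notin> {x, y, z, w}" "(a, x) \<in> ?H \<and> (a, z) \<in> ?H \<or> (a, y) \<in> ?H \<and> (a, w) \<in> ?H" for a
    proof -
      have "(a, x) \<in> ?G" using gain[OF xy, of a] that by blast
      moreover have "(a, w) \<in> ?G" using gain[OF wH(2) wz, of a] that by blast
      ultimately show False using tri[of a x w] wG symG by blast
    qed
    \<comment> \<open>A fifth vertex is essential: the paths y-w-x-z and y-x-w-z have the same
      connected triples, so four vertices alone give no contradiction.\<close>
    have "card {x, y, z, w} \<le> 4" by (simp add: card_insert_if)
    then have "{x, y, z, w} \<noteq> pverts G" using card by auto
    then obtain b a where ab: "b \<in> {x, y, z, w}" "a \<notin> {x, y, z, w}" "(b, a) \<in> ?G"
      using conn_simple_graphD(6)[OF G, of "{x, y, z, w}"]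
        conn_simple_graphD(2,3)[OF G xz] conn_simple_graphD(2,3)[OF G wG(2)] by auto
    then consider "(a, x) \<in> ?G \<or> (a, z) \<in> ?G" | "(a, w) \<in> ?G \<or> (a, y) \<in> ?G" using symG by blast
    then show False
    proof cases
      case 1
      with loss[OF xz xzH, of a] ab *[of a] show False by blast
    next
      case 2
      with loss[OF wG(2) wyH, of a] ab *[of a] show False by blast
    qed
  qed

  have sub: "?H \<subseteq> ?G"
  proof (rule ccontr)
    assume "\<not> ?H \<subseteq> ?G"
    then obtain x y where xy: "(x, y) \<in> ?H" "(x, y) \<notin> ?G" by auto
    then have yx: "(y, x) \<in> ?H" "(y, x) \<notin> ?G" using symG symH by blast+
    have "nbrs G x = nbrs G y"
      using no_private[OF xy] no_private[OF yx] by (auto simp: nbrs_def)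
    moreover have "x \<noteq> y" using xy irrH by auto
    ultimately show False
      using twin_free[of x y] xy conn_simple_graphD(2,3)[OF H xy(1)] V by simp
  qed
  moreover have "?G \<subseteq> ?H"
  proof (rule ccontr)
    assume "\<not> ?G \<subseteq> ?H"
    then obtain u v where uv: "(u, v) \<in> ?G" "(u, v) \<notin> ?H" by auto
    \<comment> \<open>By \<open>loss\<close>, \<open>w\<close> is joined to both \<open>u\<close>
      and \<open>v\<close> in \<open>H\<close>, and \<open>sub\<close> carries these edges back to
      \<open>G\<close>.\<close>
    obtain w where w: "w \<noteq> u" "w \<noteq> v" "(u, w) \<in> ?G \<or> (v, w) \<in> ?G"
      using ex_adjacent_outside_pair[OF G card3, of u v] conn_simple_graphD(2,3)[OF G uv(1)] by blast
    then have "(w, u) \<in> ?H" "(w, v) \<in> ?H" using loss[OF uv, of w] symG by blast+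
    then show False using sub tri[of u v w] uv symG by blast
  qed
  ultimately show ?thesis using V by blast
qed

text \<open>The edge \<open>ab\<close> is added to \<open>G\<close>. A third vertex \<open>c\<close>
  is adjacent to both twins or to neither, so \<open>{a, b, c}\<close> spans two or no edges before
  and three or one after: the threshold of two is not crossed. Triples missing \<open>a\<close> or
  \<open>b\<close> keep their edges.\<close>

lemma twins_imp_not_reconstructible:
  assumes G: "conn_simple_graph G" and ab: "a \<in> pverts G" "b \<in> pverts G" "a \<noteq> b"
    and nonadj: "(a, b) \<notin> parcs G" and twins: "nbrs G a = nbrs G b"
  shows "\<not> strongly_T3_reconstructible G"
proof
  assume rec: "strongly_T3_reconstructible G"
  note symG = conn_simple_graphD(4)[OF G] and irrG = conn_simple_graphD(5)[OF G]
  define H where "H = \<lparr>pverts = pverts G, parcs = parcs G \<union> {(a, b), (b, a)}\<rparr>"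
  have sel [simp]: "pverts H = pverts G" "parcs H = parcs G \<union> {(a, b), (b, a)}"
    by (simp_all add: H_def)
  interpret G: pair_graph G using G by (simp add: conn_simple_graph_def)
  have arc: "fst e \<in> pverts H" "snd e \<in> pverts H" "fst e \<noteq> snd e" if "e \<in> parcs H" for e
    using that ab irrG conn_simple_graphD(2,3)[OF G, of "fst e" "snd e"] by (cases e; auto)+
  have fin: "finite (pverts H)" "finite (parcs H)"
    using G.pair_finite_verts G.pair_finite_arcs by simp_all
  interpret H: pair_graph H
  proof
    show "symmetric (with_proj H)" using symG by (auto simp: symmetric_def intro!: symI)
  qed (fact arc fin)+
  have H: "conn_simple_graph H"
  proof -
    \<comment> \<open>The vertex set is unchanged, so an edge of \<open>G\<close> across a cut still
      crosses it in \<open>H\<close>.\<close>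
    have "Digraph_Component.connected (with_proj H)"
      unfolding connected_iff_cut
    proof (intro conjI allI impI)
      show "verts (with_proj H) \<noteq> {}" using ab by auto
      fix A assume "A \<subseteq> verts (with_proj H)" "A \<noteq> {} \<and> A \<noteq> verts (with_proj H)"
      then obtain x y where "x \<in> A" "y \<in> pverts G - A" "(x, y) \<in> parcs G"
        using conn_simple_graphD(6)[OF G, of A] by auto
      then show "\<exists>x\<in>A. \<exists>y\<in>verts (with_proj H) - A. (x, y) \<in> (arcs_ends (with_proj H))\<^sup>s"
        by (auto simp: symcl_def)
    qed
    then show ?thesis using H.pair_graph_axioms by (simp add: conn_simple_graph_def)
  qed
  have tw: "(a, w) \<in> parcs G \<longleftrightarrow> (b, w) \<in> parcs G" for w
    using twins by (auto simp: nbrs_def)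
  have "S \<in> T3 H \<longleftrightarrow> S \<in> T3 G" for S
  proof (cases "card S = 3")
    case True
    consider "a \<in> S \<and> b \<in> S" | "a \<notin> S \<or> b \<notin> S" by blast
    then show ?thesis
    proof cases
      case 1
      then have "card (S - {a, b}) = 1" using True ab by (simp add: card_Diff_subset)
      then obtain c where "S - {a, b} = {c}" by (auto simp: card_1_singleton_iff)
      with 1 have c: "S = {a, b, c}" "c \<noteq> a" "c \<noteq> b" by auto
      show ?thesis
        unfolding c(1) using c ab nonadj tw[of c]
          triple_in_T3_iff[OF G, of a b c] triple_in_T3_iff[OF H, of a b c] by auto
    next
      case 2
      obtain x y z where xyz: "S = {x, y, z}" "x \<noteq> y" "x \<noteq> z" "y \<noteq> z"
        using True by (auto simp: card_3_iff)
      with 2 show ?thesis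
        unfolding xyz(1)
        using triple_in_T3_iff[OF G, of x y z] triple_in_T3_iff[OF H, of x y z] by auto
    qed
  qed (auto simp: T3_def)
  then have "T3 H = T3 G" by blast
  with rec H have "parcs H = parcs G" unfolding strongly_T3_reconstructible_def by blast
  with nonadj show False by auto
qed

theorem theorem4p10:
  fixes G :: "'a pair_pre_digraph"
  assumes "conn_simple_graph G"
    and "triangle_free G"
    and "card (pverts G) \<ge> 5"
  shows "strongly_T3_reconstructible G \<longleftrightarrow>
    (\<forall>v\<^sub>1 \<in> pverts G. \<forall>v\<^sub>2 \<in> pverts G.
       v\<^sub>1 \<noteq> v\<^sub>2 \<and> (v\<^sub>1, v\<^sub>2) \<notin> parcs G \<longrightarrow> nbrs G v\<^sub>1 \<noteq> nbrs G v\<^sub>2)"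
  using twins_imp_not_reconstructible[OF assms(1)] T3_eq_imp_eq[OF assms]
  unfolding strongly_T3_reconstructible_def by blast

end
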